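(* Suppose $X$ and $Y$ are connected CW complexes and $f: Y \rightarrow X$ is a continuous map that possesses a splitting $s$, i.e. a continuous map $s:X \rightarrow Y$ such that $fs:X \rightarrow X$ is the identity. Then $\nu_n(Y)\geq \nu_n(X)$.
   Context: For a space $X$, $C(X)$ is the algebra of continuous complex-valued functions on $X$, and $\mathrm{M}(n,C(X))$ is the ring of $n\times n$ matrices over $C(X)$; $A^*$ denotes the pointwise conjugate transpose, and $A$ is normal if $AA^*=A^*A$. Characteristic polynomials are taken to be monic. A monic polynomial $\mu\in C(X)[\lambda]$ of degree $n$ splits over $C(X)$ if $\mu(\lambda)=\prod_{i=1}^n(\lambda-\lambda_i)$ for some $\lambda_1,\dots,\lambda_n\in C(X)$; it is multiplicity-free if for each $x\in X$ the polynomial over $\mathbb{C}$ obtained by evaluating the coefficients at $x$ has $n$ distinct roots. Matrices $A,B\in\mathrm{M}(n,C(X))$ are unitarily equivalent if $B=U^*AU$ for some $U\in\mathrm{M}(n,C(X))$ with $U^*U=UU^*=I$. For a connected CW complex $X$, $\nu_n(X)$ denotes the number (cardinality) of unitary equivalence classes of normal matrices in $\mathrm{M}(n,C(X))$ with a given characteristic polynomial $\mu$ of degree $n$ that is multiplicity-free and splits over $C(X)$; this number does not depend on the choice of such $\mu$. *)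

theory Defs
  imports
    "HOL-Analysis.Abstract_Euclidean_Space"
    "Jordan_Normal_Form.Schur_Decomposition"
begin

unbundle cardinal_syntax

text \<open>
  CW complexes in the sense of Whitehead. The open cells are themselves the indices: \<open>E\<close> is the
  set of open cells, and a cell \<open>e\<close> has dimension \<open>d e\<close> and characteristic map \<open>\<Phi> e\<close>, defined on
  the closed unit disk of \<open>\<real>\<^sup>d\<close> for \<open>d = d e\<close>. For \<open>d e = 0\<close> the disk is a point, equal to its
  interior, with empty boundary.
\<close>

definition unit_disk :: "nat \<Rightarrow> (nat \<Rightarrow> real) topology" where
  "unit_disk k = subtopology (Euclidean_space k) {x. (\<Sum>i<k. (x i)\<^sup>2) \<le> 1}"

definition disk_interior :: "nat \<Rightarrow> (nat \<Rightarrow> real) set" where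
  "disk_interior k = {x \<in> topspace (unit_disk k). (\<Sum>i<k. (x i)\<^sup>2) < 1}"

definition disk_boundary :: "nat \<Rightarrow> (nat \<Rightarrow> real) set" where
  "disk_boundary k = {x \<in> topspace (unit_disk k). (\<Sum>i<k. (x i)\<^sup>2) = 1}"

definition cw_structure ::
    "'a topology \<Rightarrow> 'a set set \<Rightarrow> ('a set \<Rightarrow> nat) \<Rightarrow> ('a set \<Rightarrow> (nat \<Rightarrow> real) \<Rightarrow> 'a) \<Rightarrow> bool" where
  "cw_structure X E d \<Phi> \<longleftrightarrow>
     \<Union>E = topspace X \<and> pairwise disjnt E \<and>
     (\<forall>e\<in>E. continuous_map (unit_disk (d e)) X (\<Phi> e) \<and>
        homeomorphic_map (subtopology (unit_disk (d e)) (disk_interior (d e)))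
                         (subtopology X e) (\<Phi> e)) \<and>
     \<comment> \<open>closure finiteness\<close>
     (\<forall>e\<in>E. \<exists>F\<subseteq>E. finite F \<and> (\<forall>e'\<in>F. d e' < d e) \<and> \<Phi> e ` disk_boundary (d e) \<subseteq> \<Union>F) \<and>
     \<comment> \<open>weak topology\<close>
     (\<forall>A\<subseteq>topspace X. closedin X A \<longleftrightarrow>
        (\<forall>e\<in>E. closedin (unit_disk (d e)) {x \<in> topspace (unit_disk (d e)). \<Phi> e x \<in> A}))"

definition CW_complex :: "'a topology \<Rightarrow> bool" where
  "CW_complex X \<longleftrightarrow> Hausdorff_space X \<and> (\<exists>E d \<Phi>. cw_structure X E d \<Phi>)"

text \<open>
  An element of \<open>M(n, C(X))\<close> is a matrix-valued function on the points of \<open>X\<close> with continuous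
  entries. As all operations on such matrices are pointwise, so are the notions below.
  The extensional function space makes equality of such functions agree with equality on \<open>X\<close>.
\<close>

definition cmat :: "nat \<Rightarrow> 'a topology \<Rightarrow> ('a \<Rightarrow> complex mat) set" where
  "cmat n X = {A \<in> topspace X \<rightarrow>\<^sub>E carrier_mat n n.
     \<forall>i<n. \<forall>j<n. continuous_map X euclidean (\<lambda>x. A x $$ (i, j))}"

definition normal_cmat :: "nat \<Rightarrow> 'a topology \<Rightarrow> ('a \<Rightarrow> complex mat) \<Rightarrow> bool" where
  "normal_cmat n X A \<longleftrightarrow> A \<in> cmat n X \<and>
     (\<forall>x\<in>topspace X. A x * mat_adjoint (A x) = mat_adjoint (A x) * A x)"

definition unitary_cmat :: "nat \<Rightarrow> 'a topology \<Rightarrow> ('a \<Rightarrow> complex mat) \<Rightarrow> bool" where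
  "unitary_cmat n X U \<longleftrightarrow> U \<in> cmat n X \<and>
     (\<forall>x\<in>topspace X. mat_adjoint (U x) * U x = 1\<^sub>m n \<and> U x * mat_adjoint (U x) = 1\<^sub>m n)"

definition unitarily_equivalent ::
    "nat \<Rightarrow> 'a topology \<Rightarrow> ('a \<Rightarrow> complex mat) \<Rightarrow> ('a \<Rightarrow> complex mat) \<Rightarrow> bool" where
  "unitarily_equivalent n X A B \<longleftrightarrow>
     (\<exists>U. unitary_cmat n X U \<and> (\<forall>x\<in>topspace X. B x = mat_adjoint (U x) * A x * U x))"

text \<open>
  A polynomial \<open>\<mu>\<close> in \<open>C(X)[\<lambda>]\<close> is represented by the family of its evaluations \<open>\<mu> x\<close> at the points
  of \<open>X\<close>; its values outside of \<open>X\<close> are irrelevant.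
\<close>

definition monic_cpoly :: "nat \<Rightarrow> 'a topology \<Rightarrow> ('a \<Rightarrow> complex poly) \<Rightarrow> bool" where
  "monic_cpoly n X \<mu> \<longleftrightarrow>
     (\<forall>k. continuous_map X euclidean (\<lambda>x. coeff (\<mu> x) k)) \<and>
     (\<forall>x\<in>topspace X. degree (\<mu> x) = n \<and> lead_coeff (\<mu> x) = 1)"

definition splits :: "nat \<Rightarrow> 'a topology \<Rightarrow> ('a \<Rightarrow> complex poly) \<Rightarrow> bool" where
  "splits n X \<mu> \<longleftrightarrow>
     (\<exists>r :: nat \<Rightarrow> 'a \<Rightarrow> complex. (\<forall>i<n. continuous_map X euclidean (r i)) \<and>
        (\<forall>x\<in>topspace X. \<mu> x = (\<Prod>i<n. [:- r i x, 1:])))"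

definition multiplicity_free :: "nat \<Rightarrow> 'a topology \<Rightarrow> ('a \<Rightarrow> complex poly) \<Rightarrow> bool" where
  "multiplicity_free n X \<mu> \<longleftrightarrow> (\<forall>x\<in>topspace X. card {z. poly (\<mu> x) z = 0} = n)"

definition normal_with_char_poly ::
    "nat \<Rightarrow> 'a topology \<Rightarrow> ('a \<Rightarrow> complex poly) \<Rightarrow> ('a \<Rightarrow> complex mat) set" where
  "normal_with_char_poly n X \<mu> =
     {A. normal_cmat n X A \<and> (\<forall>x\<in>topspace X. char_poly (A x) = \<mu> x)}"

definition unitary_classes ::
    "nat \<Rightarrow> 'a topology \<Rightarrow> ('a \<Rightarrow> complex poly) \<Rightarrow> ('a \<Rightarrow> complex mat) set set" where
  "unitary_classes n X \<mu> =
     normal_with_char_poly n X \<mu> //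
       {(A, B). A \<in> normal_with_char_poly n X \<mu> \<and> B \<in> normal_with_char_poly n X \<mu> \<and>
                unitarily_equivalent n X A B}"

definition admissible :: "nat \<Rightarrow> 'a topology \<Rightarrow> ('a \<Rightarrow> complex poly) \<Rightarrow> bool" where
  "admissible n X \<mu> \<longleftrightarrow> monic_cpoly n X \<mu> \<and> multiplicity_free n X \<mu> \<and> splits n X \<mu>"

text \<open>
  The cardinal \<open>\<nu>\<^sub>n(X)\<close>, computed with the polynomial \<open>\<mu>\<close>. It is meant only for admissible \<open>\<mu>\<close>, and
  up to equality of cardinals it does not depend on which one is taken. So an inequality
  between values of \<open>\<nu>\<^sub>n\<close> is to be stated for all admissible choices.
\<close>

definition nu :: "nat \<Rightarrow> 'a topology \<Rightarrow> ('a \<Rightarrow> complex poly) \<Rightarrow> ('a \<Rightarrow> complex mat) set rel" where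
  "nu n X \<mu> = |unitary_classes n X \<mu>|"

end

theory Submission
  imports Defs
begin

text \<open>
  A normal matrix whose characteristic polynomial has the continuous, pointwise distinct roots
  \<open>r\<^sub>i\<close> is determined by these roots and by its continuous family of spectral projections, and
  unitary equivalence is a relation between the projections alone. So the roots may be exchanged for
  any other continuous functions \<open>t\<^sub>i\<close> while the projections are kept
  (\<open>replace_roots\<close>). This changes the characteristic polynomial as
  prescribed (\<open>replace_roots_normal_with_char_poly\<close>), respects unitary equivalence
  (\<open>replace_roots_unitarily_equivalent\<close>), and can be undone if the \<open>t\<^sub>i\<close> are distinct at each point
  (\<open>replace_roots_inverse\<close>).

  Given \<open>A\<close> over \<open>X\<close>, its pullback \<open>A \<circ> f\<close> over \<open>Y\<close> has the roots \<open>r\<^sub>i \<circ> f\<close>; exchange these for the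
  roots of \<open>\<eta>\<close>. The matrix \<open>T A\<close> so obtained remembers the unitary class of \<open>A\<close>: as \<open>f \<circ> s\<close> is the
  identity, pulling \<open>T A\<close> back along \<open>s\<close> gives \<open>A\<close> with other roots, and restoring the roots \<open>r\<^sub>i\<close>
  gives \<open>A\<close> itself. Hence unitary equivalence of \<open>T A\<close> and \<open>T B\<close> implies that of \<open>A\<close> and \<open>B\<close>, and
  \<open>T\<close> induces an injection of the unitary classes over \<open>X\<close> into those over \<open>Y\<close>.

  The exchange of roots has to be continuous, although unitary matrices that diagonalise \<open>A\<close> can in
  general not be chosen continuously in the point. It is therefore defined as a polynomial in the
  matrix, at each point the one that takes the value \<open>t\<^sub>i\<close> at \<open>r\<^sub>i\<close>. In Newton's form its
  coefficients are divided differences, which are visibly continuous in the point. A unitary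
  diagonalisation, chosen separately at each point, serves only to compute the value of this
  polynomial.
\<close>

section \<open>The adjoint of a matrix\<close>

lemma mat_adjoint_dim [simp]:
  "dim_row (mat_adjoint A) = dim_col A" "dim_col (mat_adjoint A) = dim_row A"
  by (simp_all add: mat_adjoint_def)

lemma mat_adjoint_carrier [simp, intro]:
  "A \<in> carrier_mat n m \<Longrightarrow> mat_adjoint A \<in> carrier_mat m n"
  by auto

lemma mat_adjoint_index [simp]:
  "i < dim_col A \<Longrightarrow> j < dim_row A \<Longrightarrow> mat_adjoint A $$ (i, j) = conjugate (A $$ (j, i))"
  by (simp add: mat_adjoint_def mat_of_rows_def)

lemma mat_adjoint_mat_adjoint [simp]: "mat_adjoint (mat_adjoint A) = A"
  by (intro eq_matI) auto

lemma mat_adjoint_mult: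
  fixes A B :: "'a :: conjugatable_field mat"
  assumes "A \<in> carrier_mat n m" "B \<in> carrier_mat m k"
  shows "mat_adjoint (A * B) = mat_adjoint B * mat_adjoint A"
  using assms
  by (intro eq_matI)
    (auto simp: scalar_prod_def sum_conjugate conjugate_dist_mul mult.commute intro!: sum.cong)

lemma mat_adjoint_one [simp]: "mat_adjoint (1\<^sub>m n :: complex mat) = 1\<^sub>m n"
  by (intro eq_matI) auto

lemma mat_adjoint_mat_diag:
  "mat_adjoint (mat_diag n d :: complex mat) = mat_diag n (\<lambda>i. cnj (d i))"
  by (intro eq_matI) (auto simp: mat_diag_def)

lemma scalar_prod_mat_adjoint:
  fixes A :: "'a :: conjugatable_field mat"
  assumes A: "A \<in> carrier_mat n m" and v: "v \<in> carrier_vec n" and w: "w \<in> carrier_vec m"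
  shows "(mat_adjoint A *\<^sub>v v) \<bullet>c w = v \<bullet>c (A *\<^sub>v w)"
proof -
  have "(mat_adjoint A *\<^sub>v v) \<bullet>c w
      = (\<Sum>j<m. \<Sum>i<n. conjugate (A $$ (i, j)) * v $ i * conjugate (w $ j))"
    using assms by (simp add: scalar_prod_def sum_distrib_right atLeast0LessThan)
  also have "\<dots> = (\<Sum>i<n. \<Sum>j<m. conjugate (A $$ (i, j)) * v $ i * conjugate (w $ j))"
    by (rule sum.swap)
  also have "\<dots> = v \<bullet>c (A *\<^sub>v w)"
    using assms
    by (simp add: scalar_prod_def sum_distrib_left atLeast0LessThan sum_conjugate
        conjugate_dist_mul mult_ac)
  finally show ?thesis .
qed

section \<open>Diagonalisation of normal matrices with distinct eigenvalues\<close>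

text \<open>
  As \<open>A\<close> and its adjoint \<open>A*\<close> commute, \<open>A* v\<close> lies in the eigenspace of \<open>A\<close> for \<open>k\<close> along with \<open>v\<close>,
  and so does \<open>w = A* v - cnj k \<cdot> v\<close>. But \<open>w\<close> is orthogonal to that eigenspace: for \<open>A u = k u\<close>, the
  product of \<open>A* v\<close> with \<open>u\<close> is the product of \<open>v\<close> with \<open>k u\<close>, hence equals that of \<open>cnj k \<cdot> v\<close>
  with \<open>u\<close>. So \<open>w = 0\<close>.
\<close>

lemma normal_mat_adjoint_eigenvector:
  fixes A :: "complex mat"
  assumes A: "A \<in> carrier_mat n n" and normal: "A * mat_adjoint A = mat_adjoint A * A"
    and v: "v \<in> carrier_vec n" and ev: "A *\<^sub>v v = k \<cdot>\<^sub>v v"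
  shows "mat_adjoint A *\<^sub>v v = cnj k \<cdot>\<^sub>v v"
proof -
  let ?B = "mat_adjoint A"
  have B: "?B \<in> carrier_mat n n" using A by simp
  have Bv: "?B *\<^sub>v v \<in> carrier_vec n" using B v by simp
  define w where "w = ?B *\<^sub>v v - cnj k \<cdot>\<^sub>v v"
  have w: "w \<in> carrier_vec n" using Bv v by (simp add: w_def)
  have "A *\<^sub>v (?B *\<^sub>v v) = ?B *\<^sub>v (A *\<^sub>v v)"
    using assoc_mult_mat_vec[OF A B v] assoc_mult_mat_vec[OF B A v] normal by simp
  then have ABv: "A *\<^sub>v (?B *\<^sub>v v) = k \<cdot>\<^sub>v (?B *\<^sub>v v)"
    using mult_mat_vec[OF B v] ev by simp
  have "A *\<^sub>v w = A *\<^sub>v (?B *\<^sub>v v) - A *\<^sub>v (cnj k \<cdot>\<^sub>v v)"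
    unfolding w_def using A Bv v by (intro mult_minus_distrib_mat_vec) auto
  also have "\<dots> = k \<cdot>\<^sub>v w"
    using ABv ev mult_mat_vec[OF A v] Bv v B
    by (intro eq_vecI) (auto simp: w_def algebra_simps)
  finally have Aw: "A *\<^sub>v w = k \<cdot>\<^sub>v w" .
  have "w \<bullet>c w = (?B *\<^sub>v v) \<bullet>c w - (cnj k \<cdot>\<^sub>v v) \<bullet>c w"
    unfolding w_def using Bv v w_def w by (intro minus_scalar_prod_distrib) auto
  also have "(?B *\<^sub>v v) \<bullet>c w = v \<bullet>c (k \<cdot>\<^sub>v w)"
    using scalar_prod_mat_adjoint[OF A v w] Aw by simp
  also have "\<dots> = (cnj k \<cdot>\<^sub>v v) \<bullet>c w"
    using v w by (simp add: conjugate_smult_vec)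
  finally have "w \<bullet>c w = 0" by simp
  then have w0: "w = 0\<^sub>v n" using w by simp
  show ?thesis
  proof (rule eq_vecI)
    fix i assume i: "i < dim_vec (cnj k \<cdot>\<^sub>v v)"
    with w0 have "w $ i = 0" using v by simp
    then show "(?B *\<^sub>v v) $ i = (cnj k \<cdot>\<^sub>v v) $ i" using i v B by (simp add: w_def)
  qed (use v B in auto)
qed

text \<open>
  Eigenvectors of a normal matrix for distinct eigenvalues are orthogonal, since the eigenvectors of
  \<open>A\<close> are also eigenvectors of the adjoint. So normalised eigenvectors form the columns of \<open>U\<close>. The
  eigenvalues occur in the diagonal matrix in the order given by \<open>r\<close>, which is what makes it possible
  to exchange them one by one.
\<close>

lemma normal_mat_diagonalization:
  fixes A :: "complex mat"
  assumes A: "A \<in> carrier_mat n n" and normal: "A * mat_adjoint A = mat_adjoint A * A"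
    and roots: "\<And>i. i < n \<Longrightarrow> poly (char_poly A) (r i) = 0" and inj: "inj_on r {..<n}"
  obtains U where "U \<in> carrier_mat n n" "mat_adjoint U * U = 1\<^sub>m n" "U * mat_adjoint U = 1\<^sub>m n"
    "A = U * mat_diag n r * mat_adjoint U"
proof -
  have "\<exists>v. v \<in> carrier_vec n \<and> v \<bullet>c v = 1 \<and> A *\<^sub>v v = r i \<cdot>\<^sub>v v" if i: "i < n" for i
  proof -
    from roots[OF i] have "eigenvalue A (r i)" using eigenvalue_root_char_poly[OF A] by simp
    then obtain v where v: "v \<in> carrier_vec n" "v \<noteq> 0\<^sub>v n" "A *\<^sub>v v = r i \<cdot>\<^sub>v v"
      using A unfolding eigenvalue_def eigenvector_def by auto
    have pos: "v \<bullet>c v > 0" using v by simp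
    \<comment> \<open>the factor that normalises \<open>v\<close>\<close>
    define c :: complex where "c = 1 / complex_of_real (sqrt (Re (v \<bullet>c v)))"
    have re: "v \<bullet>c v = complex_of_real (Re (v \<bullet>c v))" "Re (v \<bullet>c v) > 0"
      using pos by (auto simp: less_complex_def complex_eq_iff)
    have "c * cnj c * (v \<bullet>c v) = 1"
    proof -
      have "c * cnj c = 1 / complex_of_real (Re (v \<bullet>c v))"
        using re(2) by (simp add: c_def flip: of_real_mult)
      then show ?thesis using re by (metis divide_self_if less_irrefl of_real_eq_0_iff times_divide_eq_left mult_1)
    qed
    then have "(c \<cdot>\<^sub>v v) \<bullet>c (c \<cdot>\<^sub>v v) = 1"
      using v by (simp add: conjugate_smult_vec mult_ac)
    moreover have "A *\<^sub>v (c \<cdot>\<^sub>v v) = r i \<cdot>\<^sub>v (c \<cdot>\<^sub>v v)"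
      using mult_mat_vec[OF A v(1)] v(3) by (simp add: smult_smult_assoc mult.commute)
    ultimately show ?thesis using v(1) by (intro exI[of _ "c \<cdot>\<^sub>v v"]) auto
  qed
  then obtain v where v: "\<And>i. i < n \<Longrightarrow> v i \<in> carrier_vec n"
    and norm: "\<And>i. i < n \<Longrightarrow> v i \<bullet>c v i = 1" and ev: "\<And>i. i < n \<Longrightarrow> A *\<^sub>v v i = r i \<cdot>\<^sub>v v i"
    by metis
  have orth: "v i \<bullet>c v j = 0" if "i < n" "j < n" "i \<noteq> j" for i j
  proof -
    have "cnj (r i) * (v i \<bullet>c v j) = (mat_adjoint A *\<^sub>v v i) \<bullet>c v j"
      using normal_mat_adjoint_eigenvector[OF A normal v ev] that v[OF that(1)] v[OF that(2)] by simp
    also have "\<dots> = cnj (r j) * (v i \<bullet>c v j)"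
      using scalar_prod_mat_adjoint[OF A v v] that ev v[OF that(1)] v[OF that(2)]
      by (simp add: conjugate_smult_vec)
    finally have "(cnj (r i) - cnj (r j)) * (v i \<bullet>c v j) = 0" by (simp add: algebra_simps)
    then show ?thesis using inj that by (auto simp: inj_on_def)
  qed
  define U where "U = Matrix.mat n n (\<lambda>(i, j). v j $ i)"
  have U: "U \<in> carrier_mat n n" by (simp add: U_def)
  have U1: "mat_adjoint U * U = 1\<^sub>m n"
  proof (rule eq_matI)
    fix i j assume "i < dim_row (1\<^sub>m n :: complex mat)" "j < dim_col (1\<^sub>m n :: complex mat)"
    then have ij: "i < n" "j < n" by auto
    have "(mat_adjoint U * U) $$ (i, j) = v j \<bullet>c v i"
      using ij U v[OF ij(1)] v[OF ij(2)] by (auto simp: scalar_prod_def U_def mult.commute intro!: sum.cong)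
    also have "\<dots> = 1\<^sub>m n $$ (i, j)" using ij norm orth by auto
    finally show "(mat_adjoint U * U) $$ (i, j) = 1\<^sub>m n $$ (i, j)" .
  qed (use U in auto)
  have Ua: "mat_adjoint U \<in> carrier_mat n n" using U by simp
  have U2: "U * mat_adjoint U = 1\<^sub>m n" using mat_mult_left_right_inverse[OF Ua U U1] .
  have AU: "A * U = U * mat_diag n r"
  proof (rule eq_matI)
    fix i j assume "i < dim_row (U * mat_diag n r)" "j < dim_col (U * mat_diag n r)"
    then have ij: "i < n" "j < n" using U by (auto simp: mat_diag_def)
    have "(A * U) $$ (i, j) = (A *\<^sub>v v j) $ i"
      using ij A U v[OF ij(2)] by (auto simp: scalar_prod_def U_def intro!: sum.cong)
    also have "\<dots> = (U * mat_diag n r) $$ (i, j)"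
      using ij ev v[OF ij(2)] by (subst mat_diag_mult_right[OF U]) (simp add: U_def)
    finally show "(A * U) $$ (i, j) = (U * mat_diag n r) $$ (i, j)" .
  qed (use A U in \<open>auto simp: mat_diag_def\<close>)
  have "A = A * (U * mat_adjoint U)" using U2 A by simp
  also have "\<dots> = U * mat_diag n r * mat_adjoint U" using assoc_mult_mat[OF A U Ua] AU by simp
  finally show ?thesis using that U U1 U2 by blast
qed

section \<open>Newton interpolation in a matrix\<close>

text \<open>
  A polynomial \<open>p\<close> with \<open>p(x) = y\<close> and \<open>p(u) = v\<close> at further nodes \<open>u\<close> has the form
  \<open>p(z) = y + (z - x) q(z)\<close>, where \<open>q(u) = (v - y) / (u - x)\<close>. Here a list of pairs consists of nodes
  and values, and the list for \<open>q\<close> results from that for \<open>p\<close>.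
\<close>

definition divided_differences :: "complex \<Rightarrow> complex \<Rightarrow> (complex \<times> complex) list \<Rightarrow> (complex \<times> complex) list" where
  "divided_differences x y = map (\<lambda>(u, v). (u, (v - y) / (u - x)))"

lemma length_divided_differences [simp]: "length (divided_differences x y ps) = length ps"
  by (simp add: divided_differences_def)

lemma map_fst_divided_differences [simp]: "map fst (divided_differences x y ps) = map fst ps"
  by (simp add: divided_differences_def o_def case_prod_unfold)

function newton_interp :: "(complex \<times> complex) list \<Rightarrow> complex \<Rightarrow> complex" where
  "newton_interp [] z = 0"
| "newton_interp ((x, y) # ps) z = y + (z - x) * newton_interp (divided_differences x y ps) z"
  by pat_completeness auto
termination by (relation "measure (\<lambda>(ps, z). length ps)") auto

lemma newton_interp_node:
  "distinct (map fst ps) \<Longrightarrow> (u, v) \<in> set ps \<Longrightarrow> newton_interp ps u = v"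
proof (induction ps u arbitrary: v rule: newton_interp.induct)
  case (2 x y ps z)
  show ?case
  proof (cases "z = x")
    case True
    with 2(2,3) have "v = y" by (force simp: image_iff)
    with True show ?thesis by simp
  next
    case False
    with 2(3) have "(z, v) \<in> set ps" by auto
    then have "(z, (v - y) / (z - x)) \<in> set (divided_differences x y ps)"
      by (force simp: divided_differences_def)
    from 2(1)[OF _ this] 2(2) False show ?thesis by simp
  qed
qed simp

text \<open>
  The interpolation polynomial evaluated at an \<open>n \<times> n\<close> matrix.
\<close>

function newton_mat :: "nat \<Rightarrow> (complex \<times> complex) list \<Rightarrow> complex mat \<Rightarrow> complex mat" where
  "newton_mat n [] A = 0\<^sub>m n n"
| "newton_mat n ((x, y) # ps) A =
     y \<cdot>\<^sub>m 1\<^sub>m n + (A - x \<cdot>\<^sub>m 1\<^sub>m n) * newton_mat n (divided_differences x y ps) A"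
  by pat_completeness auto
termination by (relation "measure (\<lambda>(n, ps, A). length ps)") auto

lemma newton_mat_carrier [simp]: "A \<in> carrier_mat n n \<Longrightarrow> newton_mat n ps A \<in> carrier_mat n n"
  by (induction n ps A rule: newton_mat.induct) auto

lemma newton_mat_conj:
  assumes "P \<in> carrier_mat n n" "Q \<in> carrier_mat n n" "A \<in> carrier_mat n n"
    and PQ: "P * Q = 1\<^sub>m n" and QP: "Q * P = 1\<^sub>m n"
  shows "newton_mat n ps (P * A * Q) = P * newton_mat n ps A * Q"
  using assms(1-3) PQ QP
proof (induction n ps A rule: newton_mat.induct)
  case (1 n A)
  then show ?case by simp
next
  case (2 n x y ps A)
  note P = \<open>P \<in> carrier_mat n n\<close> and Q = \<open>Q \<in> carrier_mat n n\<close> and A = \<open>A \<in> carrier_mat n n\<close>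
  note PQ = \<open>P * Q = 1\<^sub>m n\<close> and QP = \<open>Q * P = 1\<^sub>m n\<close>
  define B where "B = newton_mat n (divided_differences x y ps) A"
  have B: "B \<in> carrier_mat n n" using A by (simp add: B_def)
  have scalar: "P * (c \<cdot>\<^sub>m 1\<^sub>m n) * Q = c \<cdot>\<^sub>m 1\<^sub>m n" for c
    using P Q PQ by (simp add: mult_smult_distrib[of _ n n _ n] mult_smult_assoc_mat[of _ n n _ n])
  have diff: "P * (A - x \<cdot>\<^sub>m 1\<^sub>m n) * Q = P * A * Q - x \<cdot>\<^sub>m 1\<^sub>m n"
    using P Q A scalar[of x]
    by (simp add: mult_minus_distrib_mat[of _ n n _ n] minus_mult_distrib_mat[of _ n n _ _ n])
  define C where "C = A - x \<cdot>\<^sub>m 1\<^sub>m n"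
  have C: "C \<in> carrier_mat n n" by (simp add: C_def minus_carrier_mat)
  have "P * C * Q * (P * B * Q) = P * C * (Q * P) * B * Q"
    using P Q B C by (simp add: assoc_mult_mat[of _ n n _ n _ n])
  also have "\<dots> = P * (C * B) * Q"
    using P Q B C QP by (simp add: assoc_mult_mat[of _ n n _ n _ n])
  finally have prod: "P * C * Q * (P * B * Q) = P * (C * B) * Q" .
  have "newton_mat n ((x, y) # ps) (P * A * Q) = y \<cdot>\<^sub>m 1\<^sub>m n + P * C * Q * (P * B * Q)"
    using 2 diff by (simp add: B_def C_def)
  also have "\<dots> = P * (y \<cdot>\<^sub>m 1\<^sub>m n) * Q + P * (C * B) * Q"
    using scalar prod by simp
  also have "\<dots> = P * (y \<cdot>\<^sub>m 1\<^sub>m n + C * B) * Q"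
    using P Q B C
    by (simp add: mult_add_distrib_mat[of _ n n _ n] add_mult_distrib_mat[of _ n n _ _ n])
  finally show ?case by (simp add: B_def C_def)
qed

lemma newton_mat_diag: "newton_mat n ps (mat_diag n d) = mat_diag n (\<lambda>i. newton_interp ps (d i))"
proof (induction n ps "mat_diag n d" rule: newton_mat.induct)
  case (1 n)
  show ?case by (intro eq_matI) (auto simp: mat_diag_def)
next
  case (2 n x y ps)
  have "mat_diag n d - x \<cdot>\<^sub>m 1\<^sub>m n = mat_diag n (\<lambda>i. d i - x)"
    by (intro eq_matI) (auto simp: mat_diag_def)
  then have "newton_mat n ((x, y) # ps) (mat_diag n d) =
      y \<cdot>\<^sub>m 1\<^sub>m n + mat_diag n (\<lambda>i. (d i - x) * newton_interp (divided_differences x y ps) (d i))"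
    using 2 by simp
  also have "\<dots> = mat_diag n (\<lambda>i. newton_interp ((x, y) # ps) (d i))"
    by (intro eq_matI) (auto simp: mat_diag_def)
  finally show ?case .
qed


text \<open>
  If \<open>r\<close> is injective, there is a polynomial with the value \<open>t i\<close> at \<open>r i\<close> for all \<open>i < n\<close>, and it
  acts on a diagonalised matrix through the eigenvalues. The right-hand side shows that the result
  has the same eigenvectors.
\<close>

lemma newton_mat_replace_diagonal:
  assumes "P \<in> carrier_mat n n" "Q \<in> carrier_mat n n" "P * Q = 1\<^sub>m n" "Q * P = 1\<^sub>m n"
    and inj: "inj_on r {..<n}"
  shows "newton_mat n (map (\<lambda>i. (r i, t i)) [0..<n]) (P * mat_diag n r * Q) = P * mat_diag n t * Q"
proof -
  let ?ps = "map (\<lambda>i. (r i, t i)) [0..<n]"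
  have "distinct (map fst ?ps)"
    using inj by (simp add: o_def distinct_map atLeast0LessThan)
  then have "newton_interp ?ps (r i) = t i" if "i < n" for i
    using that by (intro newton_interp_node) auto
  then have "mat_diag n (\<lambda>i. newton_interp ?ps (r i)) = mat_diag n t"
    by (intro eq_matI) (auto simp: mat_diag_def)
  then show ?thesis using assms by (simp add: newton_mat_conj newton_mat_diag)
qed

section \<open>Matrices with given eigenvalues in a given eigenbasis\<close>

lemma char_poly_mat_diag_conj:
  fixes d :: "nat \<Rightarrow> complex"
  assumes "P \<in> carrier_mat n n" "Q \<in> carrier_mat n n" "P * Q = 1\<^sub>m n" "Q * P = 1\<^sub>m n"
  shows "char_poly (P * mat_diag n d * Q) = (\<Prod>i<n. [:- d i, 1:])"
proof -
  have "similar_mat (P * mat_diag n d * Q) (mat_diag n d)"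
    using assms by (intro similar_matI[of _ _ P Q n]) auto
  then have "char_poly (P * mat_diag n d * Q) = char_poly (mat_diag n d)"
    by (rule char_poly_similar)
  also have "\<dots> = (\<Prod>a\<leftarrow>diag_mat (mat_diag n d). [:- a, 1:])"
    by (rule char_poly_upper_triangular[of _ n]) (auto simp: mat_diag_def)
  also have "diag_mat (mat_diag n d) = map d [0..<n]"
    by (simp add: diag_mat_def mat_diag_def)
  also have "(\<Prod>a\<leftarrow>map d [0..<n]. [:- a, 1:]) = (\<Prod>i<n. [:- d i, 1:])"
    by (simp add: prod.list_conv_set_nth atLeast0LessThan)
  finally show ?thesis .
qed

lemma normal_mat_diag_conj:
  fixes U :: "complex mat" and d :: "nat \<Rightarrow> complex"
  assumes U: "U \<in> carrier_mat n n" and U1: "mat_adjoint U * U = 1\<^sub>m n"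
  defines "B \<equiv> U * mat_diag n d * mat_adjoint U"
  shows "B * mat_adjoint B = mat_adjoint B * B"
proof -
  define V where "V = mat_adjoint U"
  have V: "V \<in> carrier_mat n n" using U by (simp add: V_def)
  have VU: "V * U = 1\<^sub>m n" using U1 by (simp add: V_def)
  have Bd: "B = U * mat_diag n d * V" by (simp add: B_def V_def)
  have mult: "U * mat_diag n c * V * (U * mat_diag n e * V) = U * mat_diag n (\<lambda>i. c i * e i) * V"
    for c e :: "nat \<Rightarrow> complex"
  proof -
    define D E where "D = mat_diag n c" and "E = mat_diag n e"
    have DE: "D \<in> carrier_mat n n" "E \<in> carrier_mat n n" by (simp_all add: D_def E_def)
    have "U * D * V * (U * E * V) = U * D * (V * U) * (E * V)"
      using U V DE by (simp add: assoc_mult_mat[of _ n n _ n _ n])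
    also have "\<dots> = U * (D * E) * V"
      unfolding VU using U V DE by (simp add: assoc_mult_mat[of _ n n _ n _ n])
    finally show ?thesis by (simp add: D_def E_def)
  qed
  have "mat_adjoint B = U * mat_diag n (\<lambda>i. cnj (d i)) * V"
  proof -
    have D: "mat_diag n d \<in> carrier_mat n n" by simp
    have "mat_adjoint B = U * (mat_adjoint (mat_diag n d) * V)"
      unfolding Bd using mat_adjoint_mult[OF mult_carrier_mat[OF U D] V] mat_adjoint_mult[OF U D]
      by (simp add: V_def)
    then show ?thesis
      using U V by (simp add: mat_adjoint_mat_diag assoc_mult_mat[of _ n n _ n _ n])
  qed
  then show ?thesis unfolding Bd by (simp add: mult mult.commute)
qed

section \<open>Continuity of matrix-valued functions\<close>

lemma cmat_carrier: "A \<in> cmat n X \<Longrightarrow> x \<in> topspace X \<Longrightarrow> A x \<in> carrier_mat n n"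
  by (auto simp: cmat_def)

lemma cmat_continuous:
  "A \<in> cmat n X \<Longrightarrow> i < n \<Longrightarrow> j < n \<Longrightarrow> continuous_map X euclidean (\<lambda>x. A x $$ (i, j))"
  by (auto simp: cmat_def)

lemma restrict_in_cmat:
  assumes "\<And>x. x \<in> topspace X \<Longrightarrow> A x \<in> carrier_mat n n"
    and "\<And>i j. i < n \<Longrightarrow> j < n \<Longrightarrow> continuous_map X euclidean (\<lambda>x. A x $$ (i, j))"
  shows "restrict A (topspace X) \<in> cmat n X"
proof -
  have "continuous_map X euclidean (\<lambda>x. restrict A (topspace X) x $$ (i, j))" if "i < n" "j < n" for i j
    using assms(2)[OF that] by (rule continuous_map_eq) simp
  then show ?thesis using assms(1) by (auto simp: cmat_def)
qed

lemma continuous_map_mult_complex: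
  fixes f g :: "'a \<Rightarrow> complex"
  shows "continuous_map X euclidean f \<Longrightarrow> continuous_map X euclidean g \<Longrightarrow>
    continuous_map X euclidean (\<lambda>x. f x * g x)"
  by (simp add: continuous_map_atin tendsto_mult)

lemma continuous_map_divide_complex:
  fixes f g :: "'a \<Rightarrow> complex"
  shows "continuous_map X euclidean f \<Longrightarrow> continuous_map X euclidean g \<Longrightarrow>
    (\<And>x. x \<in> topspace X \<Longrightarrow> g x \<noteq> 0) \<Longrightarrow> continuous_map X euclidean (\<lambda>x. f x / g x)"
  by (simp add: continuous_map_atin tendsto_divide)

lemma continuous_map_mult_mat:
  fixes A B :: "'a \<Rightarrow> complex mat"
  assumes dims: "\<And>x. x \<in> topspace X \<Longrightarrow> A x \<in> carrier_mat n n"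
      "\<And>x. x \<in> topspace X \<Longrightarrow> B x \<in> carrier_mat n n"
    and A: "\<And>i j. i < n \<Longrightarrow> j < n \<Longrightarrow> continuous_map X euclidean (\<lambda>x. A x $$ (i, j))"
    and B: "\<And>i j. i < n \<Longrightarrow> j < n \<Longrightarrow> continuous_map X euclidean (\<lambda>x. B x $$ (i, j))"
    and ij: "i < n" "j < n"
  shows "continuous_map X euclidean (\<lambda>x. (A x * B x) $$ (i, j))"
proof (rule continuous_map_eq)
  show "continuous_map X euclidean (\<lambda>x. \<Sum>k<n. A x $$ (i, k) * B x $$ (k, j))"
    using A B ij by (intro continuous_map_sum continuous_map_mult_complex) auto
next
  fix x assume "x \<in> topspace X"
  from dims[OF this] ij show "(\<Sum>k<n. A x $$ (i, k) * B x $$ (k, j)) = (A x * B x) $$ (i, j)"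
    by (auto simp: scalar_prod_def atLeast0LessThan)
qed

text \<open>
  Divided differences of continuous functions are continuous as long as the nodes are distinct at
  each point. So one step of Newton's recursion reduces the claim to a shorter list of pairs of
  functions. The induction is on the length, as the functions in the list change.
\<close>

lemma continuous_map_newton_mat:
  fixes gs :: "(('a \<Rightarrow> complex) \<times> ('a \<Rightarrow> complex)) list"
  assumes A: "A \<in> cmat n X"
    and "\<And>g h. (g, h) \<in> set gs \<Longrightarrow> continuous_map X euclidean g \<and> continuous_map X euclidean h"
    and "\<And>x. x \<in> topspace X \<Longrightarrow> distinct (map (\<lambda>(g, h). g x) gs)"
    and "i < n" "j < n"
  shows "continuous_map X euclidean
    (\<lambda>x. newton_mat n (map (\<lambda>(g, h). (g x, h x)) gs) (A x) $$ (i, j))"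
  using assms(2-)
proof (induction "length gs" arbitrary: gs i j)
  case 0
  then show ?case by simp
next
  case (Suc m)
  then obtain g h rest where gs: "gs = (g, h) # rest" by (cases gs) auto
  \<comment> \<open>the divided differences as functions of the point\<close>
  define rest' where "rest' = map (\<lambda>(u, v). (u, \<lambda>x. (v x - h x) / (u x - g x))) rest"
  have dd: "divided_differences (g x) (h x) (map (\<lambda>(g, h). (g x, h x)) rest)
      = map (\<lambda>(g, h). (g x, h x)) rest'" for x
    by (simp add: divided_differences_def rest'_def case_prod_unfold)
  have g: "continuous_map X euclidean g" and h: "continuous_map X euclidean h"
    using Suc.prems(1)[of g h] gs by auto
  have IH: "continuous_map X euclidean
      (\<lambda>x. newton_mat n (map (\<lambda>(g, h). (g x, h x)) rest') (A x) $$ (i, j))" if "i < n" "j < n" for i j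
  proof (rule Suc.hyps(1)[OF _ _ _ that])
    show "m = length rest'" using Suc.hyps(2) gs by (simp add: rest'_def)
  next
    fix u w assume "(u, w) \<in> set rest'"
    then obtain v where uv: "(u, v) \<in> set rest" and w: "w = (\<lambda>x. (v x - h x) / (u x - g x))"
      by (auto simp: rest'_def)
    have "u x - g x \<noteq> 0" if "x \<in> topspace X" for x
      using Suc.prems(2)[OF that] uv gs by force
    then show "continuous_map X euclidean u \<and> continuous_map X euclidean w"
      using Suc.prems(1)[of u v] uv gs g h unfolding w
      by (auto intro!: continuous_map_divide_complex continuous_map_diff)
  next
    fix x assume "x \<in> topspace X"
    then show "distinct (map (\<lambda>(g, h). g x) rest')"
      using Suc.prems(2)[of x] gs by (simp add: rest'_def o_def case_prod_unfold)
  qed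
  define N where "N x = newton_mat n (map (\<lambda>(g, h). (g x, h x)) rest') (A x)" for x
  define C where "C x = A x - g x \<cdot>\<^sub>m 1\<^sub>m n" for x
  have C: "continuous_map X euclidean (\<lambda>x. C x $$ (i, j))" if "i < n" "j < n" for i j
  proof -
    have "continuous_map X euclidean (\<lambda>x. A x $$ (i, j) - g x * (if i = j then 1 else 0))"
      using g cmat_continuous[OF A that] by (auto intro!: continuous_map_diff)
    then show ?thesis using that by (simp add: C_def)
  qed
  have CN: "continuous_map X euclidean (\<lambda>x. (C x * N x) $$ (i, j))"
    using cmat_carrier[OF A] Suc.prems(3,4) C IH unfolding N_def
    by (intro continuous_map_mult_mat) (auto simp: C_def minus_carrier_mat)
  have "continuous_map X euclidean (\<lambda>x. h x * (if i = j then 1 else 0) + (C x * N x) $$ (i, j))"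
    using h CN by (auto intro!: continuous_map_add)
  then show ?case
  proof (rule continuous_map_eq)
    fix x assume "x \<in> topspace X"
    then have "A x \<in> carrier_mat n n" using A by (rule cmat_carrier[rotated])
    then have N: "N x \<in> carrier_mat n n" and Cx: "C x \<in> carrier_mat n n"
      by (simp_all add: N_def C_def minus_carrier_mat)
    have "newton_mat n (map (\<lambda>(g, h). (g x, h x)) gs) (A x) = h x \<cdot>\<^sub>m 1\<^sub>m n + C x * N x"
      by (simp add: gs dd N_def C_def)
    then show "h x * (if i = j then 1 else 0) + (C x * N x) $$ (i, j)
        = newton_mat n (map (\<lambda>(g, h). (g x, h x)) gs) (A x) $$ (i, j)"
      using Suc.prems(3,4) N Cx by simp
  qed
qed

section \<open>Exchanging the roots of the characteristic polynomial\<close>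

definition replace_roots ::
    "nat \<Rightarrow> 'a topology \<Rightarrow> (nat \<Rightarrow> 'a \<Rightarrow> complex) \<Rightarrow> (nat \<Rightarrow> 'a \<Rightarrow> complex) \<Rightarrow>
      ('a \<Rightarrow> complex mat) \<Rightarrow> 'a \<Rightarrow> complex mat" where
  "replace_roots n X r t A =
     (\<lambda>x\<in>topspace X. newton_mat n (map (\<lambda>i. (r i x, t i x)) [0..<n]) (A x))"

definition distinct_roots :: "nat \<Rightarrow> 'a topology \<Rightarrow> (nat \<Rightarrow> 'a \<Rightarrow> complex) \<Rightarrow> bool" where
  "distinct_roots n X r \<longleftrightarrow> (\<forall>i<n. continuous_map X euclidean (r i)) \<and>
     (\<forall>x\<in>topspace X. inj_on (\<lambda>i. r i x) {..<n})"

abbreviation split_poly :: "nat \<Rightarrow> (nat \<Rightarrow> 'a \<Rightarrow> complex) \<Rightarrow> 'a \<Rightarrow> complex poly" where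
  "split_poly n r \<equiv> \<lambda>x. \<Prod>i<n. [:- r i x, 1:]"

text \<open>
  The roots of \<open>\<mu> x\<close> are the values \<open>r i x\<close> for \<open>i < n\<close>. That there are \<open>n\<close> of them, which
  multiplicity-freeness says, means that these values are distinct.
\<close>

lemma admissible_distinct_roots:
  assumes "admissible n X \<mu>"
  obtains r where "distinct_roots n X r" "\<And>x. x \<in> topspace X \<Longrightarrow> \<mu> x = split_poly n r x"
proof -
  from assms obtain r where cont: "\<forall>i<n. continuous_map X euclidean (r i)"
    and \<mu>: "\<forall>x\<in>topspace X. \<mu> x = (\<Prod>i<n. [:- r i x, 1:])"
    unfolding admissible_def splits_def by auto
  have "inj_on (\<lambda>i. r i x) {..<n}" if x: "x \<in> topspace X" for x
  proof (rule eq_card_imp_inj_on)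
    have "{z. poly (\<mu> x) z = 0} = (\<lambda>i. r i x) ` {..<n}"
      using \<mu> x by (auto simp: poly_prod)
    with assms x show "card ((\<lambda>i. r i x) ` {..<n}) = card {..<n}"
      unfolding admissible_def multiplicity_free_def by force
  qed simp
  with that cont \<mu> show ?thesis by (auto simp: distinct_roots_def)
qed

lemma replace_roots_cmat:
  assumes "A \<in> cmat n X" "distinct_roots n X r" "\<And>i. i < n \<Longrightarrow> continuous_map X euclidean (t i)"
  shows "replace_roots n X r t A \<in> cmat n X"
  unfolding replace_roots_def
proof (rule restrict_in_cmat)
  fix i j assume ij: "i < n" "j < n"
  have "continuous_map X euclidean (\<lambda>x. newton_mat n
      (map (\<lambda>(g, h). (g x, h x)) (map (\<lambda>i. (r i, t i)) [0..<n])) (A x) $$ (i, j))"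
    using assms ij
    by (intro continuous_map_newton_mat)
      (auto simp: distinct_roots_def o_def distinct_map atLeast0LessThan)
  then show "continuous_map X euclidean (\<lambda>x. newton_mat n
      (map (\<lambda>i. (r i x, t i x)) [0..<n]) (A x) $$ (i, j))"
    by (simp add: o_def)
qed (simp add: cmat_carrier[OF assms(1)])

text \<open>
  Exchanging roots keeps the eigenvectors, so one \<open>U\<close> serves for all choices of \<open>t\<close>. This reduces
  statements about \<open>replace_roots\<close> to statements about diagonal matrices.
\<close>

lemma normal_with_char_poly_diagonalization:
  assumes A: "A \<in> normal_with_char_poly n X (split_poly n r)" and r: "distinct_roots n X r"
    and x: "x \<in> topspace X"
  obtains U where "U \<in> carrier_mat n n" "mat_adjoint U * U = 1\<^sub>m n" "U * mat_adjoint U = 1\<^sub>m n"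
    "A x = U * mat_diag n (\<lambda>i. r i x) * mat_adjoint U"
    "\<And>t. replace_roots n X r t A x = U * mat_diag n (\<lambda>i. t i x) * mat_adjoint U"
proof -
  have c: "A x \<in> carrier_mat n n" and normal: "A x * mat_adjoint (A x) = mat_adjoint (A x) * A x"
    and cp: "char_poly (A x) = split_poly n r x"
    using A x by (auto simp: normal_with_char_poly_def normal_cmat_def cmat_def)
  have roots: "poly (char_poly (A x)) (r i x) = 0" if "i < n" for i
    using that by (auto simp: cp poly_prod)
  have inj: "inj_on (\<lambda>i. r i x) {..<n}" using r x by (auto simp: distinct_roots_def)
  obtain U where U: "U \<in> carrier_mat n n" "mat_adjoint U * U = 1\<^sub>m n"
    "U * mat_adjoint U = 1\<^sub>m n" "A x = U * mat_diag n (\<lambda>i. r i x) * mat_adjoint U"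
    using normal_mat_diagonalization[OF c normal roots inj] by blast
  have "replace_roots n X r t A x = U * mat_diag n (\<lambda>i. t i x) * mat_adjoint U" for t
    using newton_mat_replace_diagonal[of U n "mat_adjoint U" "\<lambda>i. r i x" "\<lambda>i. t i x"] U inj x
    by (simp add: replace_roots_def)
  with U show ?thesis by (rule that)
qed

lemma replace_roots_normal_with_char_poly:
  assumes A: "A \<in> normal_with_char_poly n X (split_poly n r)"
    and r: "distinct_roots n X r" and t: "\<And>i. i < n \<Longrightarrow> continuous_map X euclidean (t i)"
  shows "replace_roots n X r t A \<in> normal_with_char_poly n X (split_poly n t)"
proof -
  let ?B = "replace_roots n X r t A"
  have "A \<in> cmat n X" using A by (simp add: normal_with_char_poly_def normal_cmat_def)
  then have "?B \<in> cmat n X" using r t by (rule replace_roots_cmat)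
  moreover have "?B x * mat_adjoint (?B x) = mat_adjoint (?B x) * ?B x \<and>
      char_poly (?B x) = split_poly n t x" if x: "x \<in> topspace X" for x
  proof -
    obtain U where U: "U \<in> carrier_mat n n" "mat_adjoint U * U = 1\<^sub>m n" "U * mat_adjoint U = 1\<^sub>m n"
      and B: "?B x = U * mat_diag n (\<lambda>i. t i x) * mat_adjoint U"
      using normal_with_char_poly_diagonalization[OF A r x] by metis
    show ?thesis unfolding B
      using normal_mat_diag_conj[OF U(1,2)] char_poly_mat_diag_conj[of U n "mat_adjoint U"] U by simp
  qed
  ultimately show ?thesis by (auto simp: normal_with_char_poly_def normal_cmat_def)
qed

lemma replace_roots_inverse:
  assumes A: "A \<in> normal_with_char_poly n X (split_poly n r)"
    and r: "distinct_roots n X r" and t: "distinct_roots n X t" and x: "x \<in> topspace X"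
  shows "replace_roots n X t r (replace_roots n X r t A) x = A x"
proof -
  obtain U where U: "U \<in> carrier_mat n n" "mat_adjoint U * U = 1\<^sub>m n" "U * mat_adjoint U = 1\<^sub>m n"
      "A x = U * mat_diag n (\<lambda>i. r i x) * mat_adjoint U"
      "replace_roots n X r t A x = U * mat_diag n (\<lambda>i. t i x) * mat_adjoint U"
    using normal_with_char_poly_diagonalization[OF A r x] by metis
  moreover have "inj_on (\<lambda>i. t i x) {..<n}" using t x by (auto simp: distinct_roots_def)
  ultimately show ?thesis
    using newton_mat_replace_diagonal[of U n "mat_adjoint U" "\<lambda>i. t i x" "\<lambda>i. r i x"] x
    by (subst replace_roots_def) simp
qed

text \<open>
  Polynomials in a matrix commute with conjugation, and both sides use the same polynomial at each
  point.
\<close>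

lemma replace_roots_unitarily_equivalent:
  assumes A: "A \<in> cmat n X" and eq: "unitarily_equivalent n X A B"
  shows "unitarily_equivalent n X (replace_roots n X r t A) (replace_roots n X r t B)"
proof -
  from eq obtain U where U: "unitary_cmat n X U"
    and B: "\<And>x. x \<in> topspace X \<Longrightarrow> B x = mat_adjoint (U x) * A x * U x"
    by (auto simp: unitarily_equivalent_def)
  have "replace_roots n X r t B x = mat_adjoint (U x) * replace_roots n X r t A x * U x"
    if x: "x \<in> topspace X" for x
  proof -
    have "U x \<in> carrier_mat n n" "mat_adjoint (U x) * U x = 1\<^sub>m n" "U x * mat_adjoint (U x) = 1\<^sub>m n"
      using U x by (auto simp: unitary_cmat_def cmat_def)
    then show ?thesis
      using B[OF x] x cmat_carrier[OF A x]
      by (simp add: replace_roots_def newton_mat_conj)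
  qed
  with U show ?thesis by (auto simp: unitarily_equivalent_def)
qed

section \<open>Pullback along continuous maps\<close>

definition pullback :: "'a topology \<Rightarrow> ('a \<Rightarrow> 'b) \<Rightarrow> ('b \<Rightarrow> 'c) \<Rightarrow> 'a \<Rightarrow> 'c" where
  "pullback Y f A = (\<lambda>y\<in>topspace Y. A (f y))"

lemma pullback_cmat:
  assumes A: "A \<in> cmat n X" and f: "continuous_map Y X f"
  shows "pullback Y f A \<in> cmat n Y"
  unfolding pullback_def
proof (rule restrict_in_cmat)
  show "A (f y) \<in> carrier_mat n n" if "y \<in> topspace Y" for y
    using cmat_carrier[OF A] continuous_map_funspace[OF f] that by auto
  show "continuous_map Y euclidean (\<lambda>y. A (f y) $$ (i, j))" if "i < n" "j < n" for i j
    using continuous_map_compose[OF f cmat_continuous[OF A that]] by (simp add: o_def)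
qed

lemma pullback_normal_with_char_poly:
  assumes "A \<in> normal_with_char_poly n X \<mu>" and f: "continuous_map Y X f"
  shows "pullback Y f A \<in> normal_with_char_poly n Y (\<lambda>y. \<mu> (f y))"
  using assms continuous_map_funspace[OF f] pullback_cmat[OF _ f, of A n]
  by (auto simp: normal_with_char_poly_def normal_cmat_def pullback_def Pi_iff)

lemma pullback_unitarily_equivalent:
  assumes "unitarily_equivalent n X A B" and f: "continuous_map Y X f"
  shows "unitarily_equivalent n Y (pullback Y f A) (pullback Y f B)"
proof -
  from assms obtain U where U: "unitary_cmat n X U"
    and B: "\<And>x. x \<in> topspace X \<Longrightarrow> B x = mat_adjoint (U x) * A x * U x"
    by (auto simp: unitarily_equivalent_def)
  note fX = continuous_map_funspace[OF f]
  have "unitary_cmat n Y (pullback Y f U)"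
    using U fX pullback_cmat[OF _ f, of U n] by (auto simp: unitary_cmat_def pullback_def Pi_iff)
  moreover have "pullback Y f B y = mat_adjoint (pullback Y f U y) * pullback Y f A y * pullback Y f U y"
    if "y \<in> topspace Y" for y
    using B fX that by (auto simp: pullback_def Pi_iff)
  ultimately show ?thesis by (auto simp: unitarily_equivalent_def)
qed

lemma pullback_distinct_roots:
  assumes "distinct_roots n X r" and f: "continuous_map Y X f"
  shows "distinct_roots n Y (\<lambda>i y. r i (f y))"
  using assms continuous_map_funspace[OF f] continuous_map_compose[OF f, of euclidean]
  by (auto simp: distinct_roots_def Pi_iff o_def)

section \<open>Unitary equivalence as an equivalence relation\<close>

lemma unitarily_equivalent_refl:
  assumes "A \<in> cmat n X"
  shows "unitarily_equivalent n X A A"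
proof -
  have "unitary_cmat n X (\<lambda>x\<in>topspace X. 1\<^sub>m n)"
    unfolding unitary_cmat_def by (auto intro!: restrict_in_cmat)
  moreover have "A x = mat_adjoint (1\<^sub>m n) * A x * 1\<^sub>m n" if "x \<in> topspace X" for x
    using cmat_carrier[OF assms that] by simp
  ultimately show ?thesis
    unfolding unitarily_equivalent_def by (intro exI[of _ "\<lambda>x\<in>topspace X. 1\<^sub>m n"]) auto
qed

lemma unitarily_equivalent_sym:
  assumes A: "A \<in> cmat n X" and eq: "unitarily_equivalent n X A B"
  shows "unitarily_equivalent n X B A"
proof -
  from eq obtain U where U: "unitary_cmat n X U"
    and B: "\<And>x. x \<in> topspace X \<Longrightarrow> B x = mat_adjoint (U x) * A x * U x"
    by (auto simp: unitarily_equivalent_def)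
  have Uc: "U \<in> cmat n X" using U by (simp add: unitary_cmat_def)
  define V where "V = (\<lambda>x\<in>topspace X. mat_adjoint (U x))"
  have "V \<in> cmat n X"
    unfolding V_def
  proof (rule restrict_in_cmat)
    fix i j assume ij: "i < n" "j < n"
    have "continuous_map X euclidean (\<lambda>x. cnj (U x $$ (j, i)))"
      using cmat_continuous[OF Uc ij(2,1)] by (simp add: continuous_map_atin tendsto_cnj)
    then show "continuous_map X euclidean (\<lambda>x. mat_adjoint (U x) $$ (i, j))"
      by (rule continuous_map_eq) (use cmat_carrier[OF Uc] ij in fastforce)
  qed (use cmat_carrier[OF Uc] in auto)
  then have "unitary_cmat n X V"
    using U by (auto simp: unitary_cmat_def V_def)
  moreover have "A x = mat_adjoint (V x) * B x * V x" if x: "x \<in> topspace X" for x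
  proof -
    define P Q where "P = U x" and "Q = mat_adjoint (U x)"
    have c: "A x \<in> carrier_mat n n" "P \<in> carrier_mat n n" "Q \<in> carrier_mat n n"
      using cmat_carrier[OF A x] cmat_carrier[OF Uc x] by (auto simp: P_def Q_def)
    have UW: "P * Q = 1\<^sub>m n" using U x by (simp add: unitary_cmat_def P_def Q_def)
    have "P * (Q * A x * P) * Q = (P * Q) * A x * (P * Q)"
      using c by (simp add: assoc_mult_mat[of _ n n _ n _ n])
    then show ?thesis using x c UW B[OF x] by (simp add: V_def P_def Q_def)
  qed
  ultimately show ?thesis by (auto simp: unitarily_equivalent_def)
qed

lemma unitarily_equivalent_trans:
  assumes A: "A \<in> cmat n X" and "unitarily_equivalent n X A B" "unitarily_equivalent n X B C"
  shows "unitarily_equivalent n X A C"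
proof -
  from assms obtain U V where U: "unitary_cmat n X U" and V: "unitary_cmat n X V"
    and B: "\<And>x. x \<in> topspace X \<Longrightarrow> B x = mat_adjoint (U x) * A x * U x"
    and C: "\<And>x. x \<in> topspace X \<Longrightarrow> C x = mat_adjoint (V x) * B x * V x"
    by (auto simp: unitarily_equivalent_def)
  have Uc: "U \<in> cmat n X" and Vc: "V \<in> cmat n X" using U V by (auto simp: unitary_cmat_def)
  define W where "W = (\<lambda>x\<in>topspace X. U x * V x)"
  have W: "W \<in> cmat n X"
    unfolding W_def
    using cmat_carrier[OF Uc] cmat_carrier[OF Vc] cmat_continuous[OF Uc] cmat_continuous[OF Vc]
    by (intro restrict_in_cmat continuous_map_mult_mat mult_carrier_mat[of _ n n _ n]) auto
  have "mat_adjoint (W x) * W x = 1\<^sub>m n \<and> W x * mat_adjoint (W x) = 1\<^sub>m n \<and>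
      C x = mat_adjoint (W x) * A x * W x" if x: "x \<in> topspace X" for x
  proof -
    define P Q P' Q' where defs: "P = U x" "Q = V x" "P' = mat_adjoint (U x)" "Q' = mat_adjoint (V x)"
    have c: "A x \<in> carrier_mat n n" "P \<in> carrier_mat n n" "P' \<in> carrier_mat n n"
        "Q \<in> carrier_mat n n" "Q' \<in> carrier_mat n n"
      using cmat_carrier[OF A x] cmat_carrier[OF Uc x] cmat_carrier[OF Vc x] by (auto simp: defs)
    have unit: "P * P' = 1\<^sub>m n" "Q * Q' = 1\<^sub>m n" "P' * P = 1\<^sub>m n" "Q' * Q = 1\<^sub>m n"
      using U V x by (auto simp: unitary_cmat_def defs)
    have W': "W x = P * Q" "mat_adjoint (P * Q) = Q' * P'"
      using x mat_adjoint_mult[OF cmat_carrier[OF Uc x] cmat_carrier[OF Vc x]]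
      by (simp_all add: W_def defs)
    have "Q' * P' * (P * Q) = Q' * (P' * P) * Q" "P * Q * (Q' * P') = P * (Q * Q') * P'"
      using c by (simp_all add: assoc_mult_mat[of _ n n _ n _ n])
    moreover have "C x = Q' * (P' * A x * P) * Q"
      using B[OF x] C[OF x] by (simp add: defs)
    then have "C x = Q' * P' * A x * (P * Q)"
      using c by (simp add: assoc_mult_mat[of _ n n _ n _ n])
    ultimately show ?thesis using unit c unfolding W' by simp
  qed
  with W show ?thesis unfolding unitarily_equivalent_def unitary_cmat_def by blast
qed

lemma unitarily_equivalent_cong:
  assumes "unitarily_equivalent n X A B"
    and "\<And>x. x \<in> topspace X \<Longrightarrow> A x = A' x" "\<And>x. x \<in> topspace X \<Longrightarrow> B x = B' x"
  shows "unitarily_equivalent n X A' B'"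
  using assms unfolding unitarily_equivalent_def by metis

lemma equiv_unitarily_equivalent:
  assumes "\<S> \<subseteq> cmat n X"
  shows "equiv \<S> {(A, B). A \<in> \<S> \<and> B \<in> \<S> \<and> unitarily_equivalent n X A B}"
proof (rule equivI)
  show "refl_on \<S> {(A, B). A \<in> \<S> \<and> B \<in> \<S> \<and> unitarily_equivalent n X A B}"
    using assms unitarily_equivalent_refl by (auto simp: refl_on_def)
  show "sym {(A, B). A \<in> \<S> \<and> B \<in> \<S> \<and> unitarily_equivalent n X A B}"
    using subsetD[OF assms] unitarily_equivalent_sym unfolding sym_def by fast
  show "trans {(A, B). A \<in> \<S> \<and> B \<in> \<S> \<and> unitarily_equivalent n X A B}"
    using subsetD[OF assms] unitarily_equivalent_trans unfolding trans_def by fast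
qed auto

lemma normal_with_char_poly_subset: "normal_with_char_poly n X \<mu> \<subseteq> cmat n X"
  by (auto simp: normal_with_char_poly_def normal_cmat_def)

lemma normal_with_char_poly_cong:
  "(\<And>x. x \<in> topspace X \<Longrightarrow> \<mu> x = \<eta> x) \<Longrightarrow> normal_with_char_poly n X \<mu> = normal_with_char_poly n X \<eta>"
  by (auto simp: normal_with_char_poly_def)

section \<open>Comparison of the numbers of unitary classes\<close>

text \<open>
  A map that reflects the equivalence relations suffices, because it can be applied to one chosen
  representative of each class; the resulting map on classes is injective.
\<close>

lemma card_of_quotient_le:
  assumes R: "equiv S R" and R': "equiv S' R'" and T: "T \<in> S \<rightarrow> S'"
    and reflects: "\<And>a b. a \<in> S \<Longrightarrow> b \<in> S \<Longrightarrow> (T a, T b) \<in> R' \<Longrightarrow> (a, b) \<in> R"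
  shows "|S // R| \<le>o |S' // R'|"
proof -
  define rep where "rep C = (SOME a. a \<in> C)" for C :: "'a set"
  have rep: "rep C \<in> C" "rep C \<in> S" if "C \<in> S // R" for C
  proof -
    show "rep C \<in> C" unfolding rep_def using in_quotient_imp_non_empty[OF R that] by (auto intro: someI_ex)
    then show "rep C \<in> S" using in_quotient_imp_subset[OF R that] by auto
  qed
  have "inj_on (\<lambda>C. R' `` {T (rep C)}) (S // R)"
  proof (rule inj_onI)
    fix C D assume CD: "C \<in> S // R" "D \<in> S // R" and eq: "R' `` {T (rep C)} = R' `` {T (rep D)}"
    have "T (rep D) \<in> S'" using T rep(2)[OF CD(2)] by (rule funcset_mem)
    then have "(T (rep C), T (rep D)) \<in> R'" by (rule eq_equiv_class[OF eq R'])
    then have "(rep C, rep D) \<in> R" by (rule reflects[OF rep(2)[OF CD(1)] rep(2)[OF CD(2)]])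
    then show "C = D" by (rule quotient_eqI[OF R CD rep(1)[OF CD(1)] rep(1)[OF CD(2)]])
  qed
  moreover have "(\<lambda>C. R' `` {T (rep C)}) ` (S // R) \<subseteq> S' // R'"
    using T rep by (auto intro!: quotientI)
  ultimately show ?thesis using card_of_ordLeq by blast
qed

theorem proposition3p3:
  fixes X :: "'a topology" and Y :: "'b topology"
    and f :: "'b \<Rightarrow> 'a" and s :: "'a \<Rightarrow> 'b"
    and n :: nat
    and \<mu> :: "'a \<Rightarrow> complex poly" and \<eta> :: "'b \<Rightarrow> complex poly"
  assumes "CW_complex X" and "connected_space X"
    and "CW_complex Y" and "connected_space Y"
    and "continuous_map Y X f"
    and "continuous_map X Y s"
    and "\<forall>x\<in>topspace X. f (s x) = x"
    and "admissible n X \<mu>"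
    and "admissible n Y \<eta>"
  shows "nu n X \<mu> \<le>o nu n Y \<eta>"
proof -
  note f = \<open>continuous_map Y X f\<close> and s = \<open>continuous_map X Y s\<close>
  obtain r where r: "distinct_roots n X r" and \<mu>: "\<And>x. x \<in> topspace X \<Longrightarrow> \<mu> x = split_poly n r x"
    using admissible_distinct_roots[OF \<open>admissible n X \<mu>\<close>] by blast
  obtain t where t: "distinct_roots n Y t" and \<eta>: "\<And>y. y \<in> topspace Y \<Longrightarrow> \<eta> y = split_poly n t y"
    using admissible_distinct_roots[OF \<open>admissible n Y \<eta>\<close>] by blast
  have \<mu>': "normal_with_char_poly n X \<mu> = normal_with_char_poly n X (split_poly n r)"
    and \<eta>': "normal_with_char_poly n Y \<eta> = normal_with_char_poly n Y (split_poly n t)"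
    using \<mu> \<eta> by (auto intro!: normal_with_char_poly_cong)
  define rf where "rf = (\<lambda>i y. r i (f y))"
  define ts where "ts = (\<lambda>i x. t i (s x))"
  have rf: "distinct_roots n Y rf" unfolding rf_def using r f by (rule pullback_distinct_roots)
  have ts: "distinct_roots n X ts" unfolding ts_def using t s by (rule pullback_distinct_roots)
  define T where "T A = replace_roots n Y rf t (pullback Y f A)" for A
  have T: "T A \<in> normal_with_char_poly n Y \<eta>" if "A \<in> normal_with_char_poly n X \<mu>" for A
  proof -
    have "pullback Y f A \<in> normal_with_char_poly n Y (split_poly n rf)"
      using pullback_normal_with_char_poly[OF that[unfolded \<mu>'] f] by (simp add: rf_def)
    then show ?thesis
      unfolding T_def \<eta>' using t rf
      by (intro replace_roots_normal_with_char_poly) (auto simp: distinct_roots_def)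
  qed
  \<comment> \<open>as \<open>f (s x) = x\<close>, pulling back along \<open>s\<close> undoes the pullback along \<open>f\<close> inside \<open>T\<close>\<close>
  have pullback_T: "pullback X s (T A) x = replace_roots n X r ts A x" if "x \<in> topspace X" for A x
    using that assms(7) continuous_map_funspace[OF s]
    by (auto simp: T_def pullback_def replace_roots_def rf_def ts_def Pi_iff)
  have "unitarily_equivalent n X A B"
    if A: "A \<in> normal_with_char_poly n X \<mu>" and B: "B \<in> normal_with_char_poly n X \<mu>"
      and TAB: "unitarily_equivalent n Y (T A) (T B)" for A B
  proof -
    have "unitarily_equivalent n X (replace_roots n X r ts A) (replace_roots n X r ts B)"
      using unitarily_equivalent_cong[OF pullback_unitarily_equivalent[OF TAB s] pullback_T pullback_T] .
    moreover have "replace_roots n X r ts A \<in> cmat n X"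
      using A r ts normal_with_char_poly_subset
      by (intro replace_roots_cmat) (auto simp: distinct_roots_def)
    ultimately have "unitarily_equivalent n X (replace_roots n X ts r (replace_roots n X r ts A))
        (replace_roots n X ts r (replace_roots n X r ts B))"
      by (rule replace_roots_unitarily_equivalent[rotated])
    then show ?thesis
      by (rule unitarily_equivalent_cong)
        (use A B r ts in \<open>simp_all add: \<mu>' replace_roots_inverse\<close>)
  qed
  then show ?thesis
    unfolding nu_def unitary_classes_def
    by (intro card_of_quotient_le[where T = T] equiv_unitarily_equivalent normal_with_char_poly_subset)
      (auto simp: T)
qed

end
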